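(* Let $p\in[0,1]^{\mathbb{N}}$ be such that, for $G\sim G_{n,p}$, as $n\to\infty$ through the odd integers, asymptotically almost surely (1) $G$ is neither a forest nor a circuit, and (2) every cycle in $G$ is a symmetric difference of Hamilton circuits of $G$. Then for every constant $c>0$ we have $p(n) > \frac{\log n + 2\log\log n + c}{n}$ for all sufficiently large odd $n$.
   Context: $\log$ denotes the natural logarithm. $G_{n,p}$ denotes the binomial random graph on $\{1,\dots,n\}$ in which each possible edge is present independently with probability $p(n)$; "asymptotically almost surely" means with probability tending to $1$. A "circuit" is a $2$-regular connected graph; a Hamilton circuit is a circuit subgraph containing all vertices. A cycle of $G$ is an element of the cycle space $\mathrm{Z}_1(G;\mathbb{F}_2)$ (edge sets with all degrees even, addition being symmetric difference); "every cycle is a symmetric difference of Hamilton circuits" means $\mathrm{Z}_1(G;\mathbb{F}_2)$ equals the $\mathbb{F}_2$-span of the edge sets of Hamilton circuits of $G$. *)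

theory Defs
  imports "HOL-Probability.Probability" "HOL-Probability.Product_PMF"
begin

text \<open>
  A finite simple graph is given by its vertex set \<open>V\<close> and its edge set \<open>E\<close>, where every edge is a
  two-element subset of \<open>V\<close>.
\<close>

definition all_edges :: "'a set \<Rightarrow> 'a set set" where
  "all_edges V = {e. e \<subseteq> V \<and> card e = 2}"

definition vertex_degree :: "'a set set \<Rightarrow> 'a \<Rightarrow> nat" where
  "vertex_degree E v = card {e \<in> E. v \<in> e}"

definition connected_graph :: "'a set \<Rightarrow> 'a set set \<Rightarrow> bool" where
  "connected_graph V E \<longleftrightarrow>
     V \<noteq> {} \<and> (\<forall>u\<in>V. \<forall>v\<in>V. (u, v) \<in> {(x, y). {x, y} \<in> E}\<^sup>*)"

definition is_circuit :: "'a set \<Rightarrow> 'a set set \<Rightarrow> bool" where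
  "is_circuit V E \<longleftrightarrow>
     finite V \<and> E \<subseteq> all_edges V \<and> (\<forall>v\<in>V. vertex_degree E v = 2) \<and> connected_graph V E"

definition is_forest :: "'a set \<Rightarrow> 'a set set \<Rightarrow> bool" where
  "is_forest V E \<longleftrightarrow> \<not> (\<exists>W F. W \<subseteq> V \<and> F \<subseteq> E \<and> is_circuit W F)"

definition hamilton_circuits :: "'a set \<Rightarrow> 'a set set \<Rightarrow> 'a set set set" where
  "hamilton_circuits V E = {F. F \<subseteq> E \<and> is_circuit V F}"

text \<open>
  Vectors over the two-element field indexed by edges are identified with their supports, so that
  addition is symmetric difference.
\<close>

definition cycle_space :: "'a set \<Rightarrow> 'a set set \<Rightarrow> 'a set set set" where
  "cycle_space V E = {F. F \<subseteq> E \<and> (\<forall>v\<in>V. even (vertex_degree F v))}"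

inductive_set F2_span :: "'b set set \<Rightarrow> 'b set set" for B :: "'b set set" where
  empty: "{} \<in> F2_span B"
| add: "F \<in> F2_span B \<Longrightarrow> H \<in> B \<Longrightarrow> sym_diff F H \<in> F2_span B"

text \<open>
  The binomial random graph on \<open>{1..n}\<close>, as a distribution on edge sets: one independent
  Bernoulli variable per possible edge decides whether this edge is present.
  Note that \<^const>\<open>bernoulli_pmf\<close> is only meaningful for parameters in the unit interval.
\<close>

definition gnp :: "nat \<Rightarrow> real \<Rightarrow> nat set set pmf" where
  "gnp n q = map_pmf (\<lambda>X. {e \<in> all_edges {1..n}. X e})
     (Pi_pmf (all_edges {1..n}) False (\<lambda>_. bernoulli_pmf q))"

definition odd_at_top :: "nat filter" where
  "odd_at_top = inf at_top (principal {n. odd n})"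

definition aas_odd :: "(nat \<Rightarrow> real) \<Rightarrow> (nat set \<Rightarrow> nat set set \<Rightarrow> bool) \<Rightarrow> bool" where
  "aas_odd p P \<longleftrightarrow>
     ((\<lambda>n. measure_pmf.prob (gnp n (p n)) {E. P {1..n} E}) \<longlongrightarrow> 1) odd_at_top"

end

theory Submission
  imports Defs "HOL-Real_Asymp.Real_Asymp"
begin

text \<open>
  A non-forest whose cycles are sums of Hamilton circuits is Hamiltonian, so it has no isolated
  vertex. If moreover some vertex \<open>v\<close> has degree two and the order is odd, then all Hamilton
  circuits are odd and contain the edges at \<open>v\<close>, so every cycle avoiding \<open>v\<close> has even size:
  the graph without \<open>v\<close> is bipartite and there is an independent set on half of the vertices.

  For \<open>p \<le> 16 / n\<close> isolated vertices exist with high probability, for \<open>p \<ge> 16 / n\<close> such large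
  independent sets do not, and for \<open>p \<le> (ln n + 2 * ln (ln n) + c) / n\<close> a vertex of degree at
  most two exists with probability bounded away from zero: at the upper end the number of vertices
  of degree two has mean tending to \<open>\<mu> = exp (- c) / 2\<close> and second moment tending to
  \<open>\<mu> + \<mu>\<^sup>2\<close>. Monotone coupling transports each bound to the other values of \<open>p\<close>.
\<close>

subsection \<open>Cycle spaces and parity\<close>

lemma finite_all_edges: "finite V \<Longrightarrow> finite (all_edges V)"
  by (rule finite_subset[of _ "Pow V"]) (auto simp: all_edges_def)

lemma card_sym_diff_parity:
  assumes "finite A" "finite B"
  shows "odd (card (sym_diff A B)) \<longleftrightarrow> odd (card A) \<noteq> odd (card B)"
proof -
  have "card (sym_diff A B) = card (A - B) + card (B - A)"
    using assms by (intro card_Un_disjoint) auto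
  moreover have "card A = card (A - B) + card (A \<inter> B)" "card B = card (B - A) + card (A \<inter> B)"
    using assms by (metis Int_commute card_Diff_subset_Int card_mono finite_Int inf_le1 inf_le2
        le_add_diff_inverse2)+
  ultimately show ?thesis by auto
qed

lemma vertex_degree_sym_diff_parity:
  assumes "finite A" "finite B"
  shows "odd (vertex_degree (sym_diff A B) v) \<longleftrightarrow>
    odd (vertex_degree A v) \<noteq> odd (vertex_degree B v)"
proof -
  have eq: "{e \<in> sym_diff A B. v \<in> e} = sym_diff {e \<in> A. v \<in> e} {e \<in> B. v \<in> e}" by auto
  show ?thesis
    using assms unfolding vertex_degree_def eq by (intro card_sym_diff_parity) auto
qed

lemma handshake:
  assumes "finite V" "E \<subseteq> all_edges V"
  shows "(\<Sum>v\<in>V. vertex_degree E v) = 2 * card E"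
proof -
  have "card {v \<in> V. v \<in> e} = 2" if "e \<in> E" for e
  proof -
    have "{v \<in> V. v \<in> e} = e" "card e = 2"
      using that assms(2) by (auto simp: all_edges_def)
    then show ?thesis by simp
  qed
  then show ?thesis
    using sum_multicount[of V E "\<lambda>v e. v \<in> e" 2] assms finite_subset[OF assms(2)]
    by (auto simp: vertex_degree_def finite_all_edges)
qed

lemma card_circuit: "is_circuit V F \<Longrightarrow> card F = card V"
  using handshake[of V F] by (auto simp: is_circuit_def)

text \<open>
  Two vertices \<open>x\<close>, \<open>y\<close> are joined with parity \<open>b\<close> if some edge set of that parity has odd degree
  exactly at \<open>x\<close> and \<open>y\<close>. Absence of odd even-degree sets makes the parity unique, and the parity
  relative to a chosen representative of each component is the colouring.
\<close>

lemma bipartite_if_cycles_even: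
  assumes fin: "finite E" and card2: "\<And>e. e \<in> E \<Longrightarrow> card e = 2"
    and even: "\<And>F. F \<subseteq> E \<Longrightarrow> (\<And>w. even (vertex_degree F w)) \<Longrightarrow> even (card F)"
  shows "\<exists>c :: 'a \<Rightarrow> bool. \<forall>x y. {x, y} \<in> E \<longrightarrow> c x \<noteq> c y"
proof -
  \<comment> \<open>Inequality of truth values is exclusive or. For \<open>x = y\<close> no vertex
    has odd degree, so the empty set gives \<open>J x x False\<close>, while
    \<open>J x x True\<close> would be an odd even-degree set.\<close>
  define J where "J x y b \<longleftrightarrow> (\<exists>F\<subseteq>E. (\<forall>w. odd (vertex_degree F w) \<longleftrightarrow> (w = x) \<noteq> (w = y)) \<and>
    (odd (card F) \<longleftrightarrow> b))" for x y b
  have sym: "J y x b" if "J x y b" for x y b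
  proof -
    have "((w = y) \<noteq> (w = x)) = ((w = x) \<noteq> (w = y))" for w by blast
    with that show ?thesis unfolding J_def by (simp only:)
  qed
  have trans: "J x z (b \<noteq> b')" if xy: "J x y b" and yz: "J y z b'" for x y z b b'
  proof -
    obtain F where F: "F \<subseteq> E" "\<And>w. odd (vertex_degree F w) \<longleftrightarrow> (w = x) \<noteq> (w = y)"
      "odd (card F) \<longleftrightarrow> b" using xy unfolding J_def by auto
    obtain F' where F': "F' \<subseteq> E" "\<And>w. odd (vertex_degree F' w) \<longleftrightarrow> (w = y) \<noteq> (w = z)"
      "odd (card F') \<longleftrightarrow> b'" using yz unfolding J_def by auto
    have f: "finite F" "finite F'" using F(1) F'(1) fin by (auto dest: finite_subset)
    show ?thesis
      unfolding J_def
    proof (intro exI[of _ "sym_diff F F'"] conjI allI)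
      show "sym_diff F F' \<subseteq> E" using F(1) F'(1) by auto
      show "odd (vertex_degree (sym_diff F F') w) \<longleftrightarrow> (w = x) \<noteq> (w = z)" for w
        unfolding vertex_degree_sym_diff_parity[OF f] F(2) F'(2) by blast
      show "odd (card (sym_diff F F')) \<longleftrightarrow> b \<noteq> b'"
        unfolding card_sym_diff_parity[OF f] F(3) F'(3) by blast
    qed
  qed
  have refl: "J x x False" for x
    unfolding J_def by (intro exI[of _ "{}"]) (auto simp: vertex_degree_def)
  have no_odd: "\<not> J x x True" for x
  proof
    assume "J x x True"
    then obtain F where "F \<subseteq> E" "\<And>w. even (vertex_degree F w)" "odd (card F)"
      unfolding J_def by auto
    then show False using even by blast
  qed
  have unique: "b = b'" if "J x y b" "J x y b'" for x y b b'
    using trans[OF that(1) sym[OF that(2)]] no_odd[of x] by (cases b; cases b') auto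
  have edge: "J x y True" if e: "{x, y} \<in> E" for x y
  proof -
    have "x \<noteq> y" using card2[OF e] by auto
    moreover have "{f \<in> {{x, y}}. w \<in> f} = (if w = x \<or> w = y then {{x, y}} else {})" for w
      by auto
    ultimately show ?thesis
      unfolding J_def using e by (intro exI[of _ "{{x, y}}"]) (auto simp: vertex_degree_def)
  qed
  \<comment> \<open>The choice depends on \<open>x\<close> only through the predicate
    \<open>\<lambda>z. \<exists>b. J x z b\<close>. Adjacent vertices have equal predicates, hence
    literally the same representative.\<close>
  define rep where "rep x = (SOME z. \<exists>b. J x z b)" for x
  have rep: "\<exists>b. J x (rep x) b" for x
    unfolding rep_def by (rule someI[of "\<lambda>z. \<exists>b. J x z b" x]) (use refl in blast)
  have "J x (rep x) True \<noteq> J y (rep y) True" if e: "{x, y} \<in> E" for x y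
  proof -
    have "(\<exists>b. J x z b) = (\<exists>b. J y z b)" for z
      by (rule iffI; elim exE; drule trans[OF edge[OF e]] trans[OF sym[OF edge[OF e]]]; rule exI)
    then have rep_eq: "rep x = rep y" by (simp add: rep_def)
    obtain b where b: "J x (rep x) b" using rep by auto
    have b': "J y (rep y) (True \<noteq> b)" using trans[OF sym[OF edge[OF e]] b] rep_eq by simp
    have "J x (rep x) True \<longleftrightarrow> b" "J y (rep y) True \<longleftrightarrow> \<not> b"
      using b b' unique[OF b, of True] unique[OF b', of True] by metis+
    then show ?thesis by simp
  qed
  then show ?thesis by (intro exI[of _ "\<lambda>x. J x (rep x) True"]) simp
qed

section \<open>Consequences of a cycle space spanned by Hamilton circuits\<close>

lemma F2_span_subset:
  assumes "F \<in> F2_span B" "\<And>H. H \<in> B \<Longrightarrow> H \<subseteq> E"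
  shows "F \<subseteq> E"
  using assms by induction auto

text \<open>
  The edges at a vertex of degree two lie on every Hamilton circuit, so membership of such an edge
  counts the summands modulo two, and so does the size when the order is odd.
\<close>

lemma F2_span_hamilton_parity:
  assumes V: "finite V" "odd (card V)" and E: "E \<subseteq> all_edges V"
    and v: "v \<in> V" "vertex_degree E v = 2" and e: "e \<in> E" "v \<in> e"
    and F: "F \<in> F2_span (hamilton_circuits V E)"
  shows "e \<in> F \<longleftrightarrow> odd (card F)"
  using F
proof induction
  case (add F H)
  have finE: "finite E" using E V finite_all_edges finite_subset by blast
  have "F \<subseteq> E"
    using add.hyps(1) by (rule F2_span_subset) (auto simp: hamilton_circuits_def)
  then have fin: "finite F" "finite H"
    using add.hyps(2) finE by (auto simp: hamilton_circuits_def dest: finite_subset)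
  have H: "H \<subseteq> E" "is_circuit V H"
    using add.hyps(2) by (auto simp: hamilton_circuits_def)
  have "{f \<in> H. v \<in> f} = {f \<in> E. v \<in> f}"
  proof (rule card_subset_eq)
    show "card {f \<in> H. v \<in> f} = card {f \<in> E. v \<in> f}"
      using H(2) v by (simp add: is_circuit_def vertex_degree_def)
  qed (use H finE in auto)
  then have "e \<in> H" using e by auto
  moreover have "odd (card H)" using card_circuit[OF H(2)] V by simp
  ultimately show ?case
    using add.IH by (auto simp: card_sym_diff_parity[OF fin])
qed simp

text \<open>A circuit in \<open>E\<close> is a nonempty member of the cycle space, whereas without
  Hamilton circuits the span contains only the empty set.\<close>

lemma hamiltonian_if_spanned:
  assumes E: "finite V" "E \<subseteq> all_edges V" and forest: "\<not> is_forest V E"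
    and span: "cycle_space V E = F2_span (hamilton_circuits V E)"
  shows "hamilton_circuits V E \<noteq> {}"
proof
  assume empty: "hamilton_circuits V E = {}"
  obtain W F where WF: "W \<subseteq> V" "F \<subseteq> E" "is_circuit W F"
    using forest by (auto simp: is_forest_def)
  have "even (vertex_degree F v)" for v
  proof (cases "v \<in> W")
    case False
    then have no_edge: "{e \<in> F. v \<in> e} = {}"
      using WF(3) by (auto simp: is_circuit_def all_edges_def)
    show ?thesis unfolding vertex_degree_def no_edge by simp
  qed (use WF(3) in \<open>simp add: is_circuit_def\<close>)
  then have "F \<in> F2_span {}"
    using WF(2) span empty by (auto simp: cycle_space_def)
  then have "F = {}" by cases auto
  moreover have "card F \<noteq> 0"
    using card_circuit[OF WF(3)] WF(3) by (auto simp: is_circuit_def connected_graph_def)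
  ultimately show False by simp
qed

lemma vertex_degree_mono:
  "finite E \<Longrightarrow> F \<subseteq> E \<Longrightarrow> vertex_degree F v \<le> vertex_degree E v"
  unfolding vertex_degree_def by (intro card_mono) auto

lemma degree_ge_2_if_hamiltonian:
  assumes "finite V" "E \<subseteq> all_edges V" "hamilton_circuits V E \<noteq> {}" "v \<in> V"
  shows "2 \<le> vertex_degree E v"
proof -
  obtain H where "H \<subseteq> E" "is_circuit V H"
    using assms(3) by (auto simp: hamilton_circuits_def)
  then show ?thesis
    using vertex_degree_mono[of E H v] assms finite_subset[OF assms(2) finite_all_edges]
    by (auto simp: is_circuit_def)
qed

text \<open>A cycle avoiding \<open>v\<close> misses the edge \<open>e\<close> at \<open>v\<close>,
  so it has even size by the parity lemma and the graph without \<open>v\<close> is 2-colourable. As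
  \<open>card V\<close> is odd, the larger colour class on \<open>V - {v}\<close> has at least
  \<open>card V div 2\<close> vertices.\<close>

lemma independent_set_if_degree_2:
  assumes V: "finite V" "odd (card V)" and E: "E \<subseteq> all_edges V"
    and span: "cycle_space V E = F2_span (hamilton_circuits V E)"
    and v: "v \<in> V" "vertex_degree E v = 2"
  shows "\<exists>S\<subseteq>V. card S = card V div 2 \<and> E \<inter> all_edges S = {}"
proof -
  obtain e where e: "e \<in> E" "v \<in> e"
  proof -
    have "{f \<in> E. v \<in> f} \<noteq> {}" using v(2) unfolding vertex_degree_def by (metis card.empty zero_neq_numeral)
    then show ?thesis using that by blast
  qed
  define E' where "E' = {f \<in> E. v \<notin> f}"
  have finE: "finite E" using E V finite_all_edges finite_subset by blast
  have "\<exists>c :: 'a \<Rightarrow> bool. \<forall>x y. {x, y} \<in> E' \<longrightarrow> c x \<noteq> c y"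
  proof (rule bipartite_if_cycles_even[of E'])
    show "finite E'" using finE by (simp add: E'_def)
    show "card f = 2" if "f \<in> E'" for f
      using that E by (auto simp: E'_def all_edges_def)
    fix F assume F: "F \<subseteq> E'" "\<And>w. even (vertex_degree F w)"
    then have "F \<in> cycle_space V E" by (auto simp: cycle_space_def E'_def)
    moreover have "e \<notin> F" using F(1) e by (auto simp: E'_def)
    ultimately show "even (card F)"
      using F2_span_hamilton_parity[OF V E v e] span by blast
  qed
  then obtain c :: "'a \<Rightarrow> bool" where c: "\<And>x y. {x, y} \<in> E' \<Longrightarrow> c x \<noteq> c y"
    by blast
  define S where "S b = {x \<in> V - {v}. c x = b}" for b
  have "card (S True) + card (S False) = card (S True \<union> S False)"
    using V(1) by (intro card_Un_disjoint[symmetric]) (auto simp: S_def)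
  also have "S True \<union> S False = V - {v}" by (auto simp: S_def)
  also have "card (V - {v}) = 2 * (card V div 2)"
    using V v(1) by simp
  finally have "card V div 2 \<le> card (S True) \<or> card V div 2 \<le> card (S False)" by linarith
  then obtain b where "card V div 2 \<le> card (S b)" by blast
  then obtain T where T: "T \<subseteq> S b" "card T = card V div 2"
    by (meson obtain_subset_with_card_n)
  have "f \<notin> all_edges T" if f: "f \<in> E" for f
  proof
    assume fT: "f \<in> all_edges T"
    then obtain x y where xy: "f = {x, y}" by (auto simp: all_edges_def card_2_iff)
    then have "x \<in> S b" "y \<in> S b" using fT T(1) by (auto simp: all_edges_def)
    moreover from this have "f \<in> E'" using f xy by (auto simp: E'_def S_def)
    ultimately show False using c[of x y] xy by (simp add: S_def)
  qed
  then show ?thesis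
    using T by (intro exI[of _ T]) (auto simp: S_def)
qed

subsection \<open>Random subsets\<close>

text \<open>An arbitrary ground set allows restriction to stars, single edges and the edges inside a
  vertex set.\<close>

definition random_subset :: "'a set \<Rightarrow> real \<Rightarrow> 'a set pmf" where
  "random_subset I q =
     map_pmf (\<lambda>X. {e \<in> I. X e}) (Pi_pmf I False (\<lambda>_. bernoulli_pmf q))"

lemma gnp_eq_random_subset: "gnp n q = random_subset (all_edges {1..n}) q"
  by (simp add: gnp_def random_subset_def)

lemma set_pmf_random_subset: "set_pmf (random_subset I q) \<subseteq> Pow I"
  by (auto simp: random_subset_def)

lemma random_subset_Int:
  assumes "finite I" "A \<subseteq> I"
  shows "map_pmf (\<lambda>X. X \<inter> A) (random_subset I q) = random_subset A q"
proof -
  have "random_subset A q = map_pmf (\<lambda>X. {e \<in> I. X e} \<inter> A)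
      (Pi_pmf I False (\<lambda>_. bernoulli_pmf q))"
    unfolding random_subset_def Pi_pmf_subset[OF assms] pmf.map_comp o_def
    using assms by (intro map_pmf_cong) auto
  then show ?thesis
    by (simp add: random_subset_def pmf.map_comp o_def)
qed

lemma random_subset_pair:
  assumes "finite I" "A \<subseteq> I" "B \<subseteq> I" "A \<inter> B = {}"
  shows "map_pmf (\<lambda>X. (X \<inter> A, X \<inter> B)) (random_subset I q) =
    pair_pmf (random_subset A q) (random_subset B q)"
proof -
  have fin: "finite A" "finite B"
    using assms by (auto dest: finite_subset)
  have "map_pmf (\<lambda>X. (X \<inter> A, X \<inter> B)) (random_subset I q) =
      map_pmf (\<lambda>X. (X \<inter> A, X \<inter> B)) (random_subset (A \<union> B) q)"
    using assms by (subst random_subset_Int[symmetric, of I])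
      (auto simp: pmf.map_comp o_def Int_assoc intro!: map_pmf_cong)
  also have "\<dots> = map_pmf (map_prod (\<lambda>X. {e \<in> A. X e}) (\<lambda>X. {e \<in> B. X e}))
      (pair_pmf (Pi_pmf A False (\<lambda>_. bernoulli_pmf q)) (Pi_pmf B False (\<lambda>_. bernoulli_pmf q)))"
    unfolding random_subset_def Pi_pmf_union[OF fin assms(4)] pmf.map_comp o_def
    using assms(4) by (intro map_pmf_cong) auto
  also have "\<dots> = pair_pmf (random_subset A q) (random_subset B q)"
    by (simp add: random_subset_def map_prod_def map_pair)
  finally show ?thesis .
qed

lemma card_random_subset:
  assumes "finite I" "q \<in> {0..1}"
  shows "map_pmf card (random_subset I q) = binomial_pmf (card I) q"
  using binomial_pmf_altdef'[OF assms(1) refl assms(2), of False]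
  by (simp add: random_subset_def pmf.map_comp o_def)

lemma card_Int_random_subset:
  assumes "finite I" "A \<subseteq> I" "q \<in> {0..1}"
  shows "map_pmf (\<lambda>X. card (X \<inter> A)) (random_subset I q) = binomial_pmf (card A) q"
proof -
  have "map_pmf (\<lambda>X. card (X \<inter> A)) (random_subset I q) =
      map_pmf card (map_pmf (\<lambda>X. X \<inter> A) (random_subset I q))"
    by (simp add: pmf.map_comp o_def)
  also have "\<dots> = binomial_pmf (card A) q"
    using assms by (simp only: random_subset_Int)
      (auto intro: card_random_subset dest: finite_subset)
  finally show ?thesis .
qed

text \<open>Used with the two stars at a pair of vertices, without their common edge, and that edge
  itself. Splitting off one block at a time reduces the claim to independence of two blocks.\<close>

lemma card_triple_random_subset:
  assumes "finite I" "A \<subseteq> I" "B \<subseteq> I" "C \<subseteq> I" "A \<inter> B = {}" "A \<inter> C = {}" "B \<inter> C = {}"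
    and q: "q \<in> {0..1}"
  shows "map_pmf (\<lambda>X. (card (X \<inter> A), card (X \<inter> B), card (X \<inter> C))) (random_subset I q) =
    pair_pmf (binomial_pmf (card A) q)
      (pair_pmf (binomial_pmf (card B) q) (binomial_pmf (card C) q))"
proof -
  have fin: "finite A" "finite B" "finite C"
    using assms by (auto dest: finite_subset)
  have "map_pmf (\<lambda>X. (card (X \<inter> A), card (X \<inter> B), card (X \<inter> C))) (random_subset I q) =
      map_pmf (map_prod card (\<lambda>X. map_prod card card (X \<inter> B, X \<inter> C)))
        (map_pmf (\<lambda>X. (X \<inter> A, X \<inter> (B \<union> C))) (random_subset I q))"
    by (auto simp: pmf.map_comp o_def Int_assoc intro!: map_pmf_cong arg_cong[where f = card])
  also have "map_pmf (\<lambda>X. (X \<inter> A, X \<inter> (B \<union> C))) (random_subset I q) =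
      pair_pmf (random_subset A q) (random_subset (B \<union> C) q)"
    using assms by (intro random_subset_pair) auto
  also have "map_pmf (map_prod card (\<lambda>X. map_prod card card (X \<inter> B, X \<inter> C))) \<dots> =
      pair_pmf (map_pmf card (random_subset A q))
        (map_pmf (map_prod card card)
          (map_pmf (\<lambda>X. (X \<inter> B, X \<inter> C)) (random_subset (B \<union> C) q)))"
    by (simp add: map_prod_def map_pair pmf.map_comp o_def)
  also have "map_pmf (\<lambda>X. (X \<inter> B, X \<inter> C)) (random_subset (B \<union> C) q) =
      pair_pmf (random_subset B q) (random_subset C q)"
    using assms fin by (intro random_subset_pair) auto
  also have "map_pmf (map_prod card card) \<dots> =
      pair_pmf (map_pmf card (random_subset B q)) (map_pmf card (random_subset C q))"
    by (simp add: map_prod_def map_pair)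
  finally show ?thesis
    using fin q by (simp add: card_random_subset)
qed

section \<open>Thinning and monotone coupling\<close>

lemma bernoulli_pmf_mult:
  assumes "q \<in> {0..1}" "r \<in> {0..1}"
  shows "map_pmf (\<lambda>(a, b). a \<and> b) (pair_pmf (bernoulli_pmf q) (bernoulli_pmf r)) =
    bernoulli_pmf (q * r)"
proof -
  have qr: "q * r \<in> {0..1}"
    using assms by (auto intro: mult_le_one)
  have "pmf (map_pmf (\<lambda>(a, b). a \<and> b) (pair_pmf (bernoulli_pmf q) (bernoulli_pmf r))) x =
      pmf (bernoulli_pmf (q * r)) x" for x
    using assms qr
    by (cases x) (auto simp: pair_pmf_def map_bind_pmf pmf_bind indicator_def algebra_simps)
  then show ?thesis
    by (intro pmf_eqI)
qed

text \<open>Both sets are built on one space: the smaller arises from the larger by keeping each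
  element independently with probability \<open>p / q\<close>. The case \<open>q = 0\<close> is
  separate because then \<open>p = 0\<close> and the ratio carries no information.\<close>

lemma random_subset_mono:
  assumes "finite I" "0 \<le> p" "p \<le> q" "q \<le> 1"
    and mono: "\<And>X Y. X \<subseteq> Y \<Longrightarrow> Y \<subseteq> I \<Longrightarrow> P X \<Longrightarrow> P Y"
  shows "measure_pmf.prob (random_subset I p) {X. P X} \<le>
    measure_pmf.prob (random_subset I q) {X. P X}"
proof (cases "q = 0")
  case False
  define r where "r = p / q"
  have r: "r \<in> {0..1}" "p = q * r"
    using assms False by (auto simp: r_def)
  let ?M = "Pi_pmf I (False, False) (\<lambda>_. pair_pmf (bernoulli_pmf q) (bernoulli_pmf r))"
  have p: "random_subset I p = map_pmf (\<lambda>h. {e \<in> I. fst (h e) \<and> snd (h e)}) ?M"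
  proof -
    have "Pi_pmf I False (\<lambda>_. bernoulli_pmf p) = map_pmf (\<lambda>h. (\<lambda>(a, b). a \<and> b) \<circ> h) ?M"
      using assms r bernoulli_pmf_mult[of q r] by (subst Pi_pmf_map[symmetric]) auto
    then show ?thesis
      by (simp add: random_subset_def pmf.map_comp o_def case_prod_unfold)
  qed
  have q: "random_subset I q = map_pmf (\<lambda>h. {e \<in> I. fst (h e)}) ?M"
  proof -
    have "Pi_pmf I False (\<lambda>_. bernoulli_pmf q) = map_pmf (\<lambda>h. fst \<circ> h) ?M"
      using assms by (subst Pi_pmf_map[symmetric]) (auto simp: map_fst_pair_pmf)
    then show ?thesis
      by (simp add: random_subset_def pmf.map_comp o_def)
  qed
  have "{h. P {e \<in> I. fst (h e) \<and> snd (h e)}} \<subseteq> {h. P {e \<in> I. fst (h e)}}"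
  proof (intro Collect_mono impI)
    fix h assume "P {e \<in> I. fst (h e) \<and> snd (h e)}"
    then show "P {e \<in> I. fst (h e)}"
      by (rule mono[rotated 2]) auto
  qed
  then show ?thesis
    unfolding p q measure_map_pmf vimage_def
    by (intro measure_pmf.finite_measure_mono) auto
qed (use assms in auto)

lemma prob_Int_empty_random_subset:
  assumes "finite I" "A \<subseteq> I" "q \<in> {0..1}"
  shows "measure_pmf.prob (random_subset I q) {X. X \<inter> A = {}} = (1 - q) ^ card A"
proof -
  have "measure_pmf.prob (random_subset I q) {X. X \<inter> A = {}} =
      measure_pmf.prob (map_pmf (\<lambda>X. card (X \<inter> A)) (random_subset I q)) {0}"
    using finite_subset[OF assms(2,1)] by (simp add: vimage_def)
  also have "\<dots> = (1 - q) ^ card A"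
    using assms by (simp add: card_Int_random_subset measure_pmf_single)
  finally show ?thesis .
qed

text \<open>
  The bound comes from \<open>indicator U \<ge> 2 * s * X - s\<^sup>2 * X\<^sup>2\<close> with \<open>X\<close> the number of events that
  occur and \<open>s = E[X] / E[X\<^sup>2]\<close>.
\<close>

lemma second_moment:
  fixes M :: "'a pmf" and P :: "'v \<Rightarrow> 'a \<Rightarrow> bool"
  assumes "finite V"
  shows "(\<Sum>v\<in>V. measure_pmf.prob M {x. P v x})\<^sup>2 /
      (\<Sum>u\<in>V. \<Sum>v\<in>V. measure_pmf.prob M {x. P u x \<and> P v x}) \<le>
    measure_pmf.prob M {x. \<exists>v\<in>V. P v x}"
proof -
  define E1 where "E1 = (\<Sum>v\<in>V. measure_pmf.prob M {x. P v x})"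
  define E2 where "E2 = (\<Sum>u\<in>V. \<Sum>v\<in>V. measure_pmf.prob M {x. P u x \<and> P v x})"
  define s where "s = E1 / E2"
  define X :: "'a \<Rightarrow> real" where "X x = (\<Sum>v\<in>V. indicator {x. P v x} x)" for x
  have X2: "(X x)\<^sup>2 = (\<Sum>u\<in>V. \<Sum>v\<in>V. indicator {x. P u x \<and> P v x} x)" for x
    unfolding X_def power2_eq_square sum_product
    by (intro sum.cong) (auto simp: indicator_def)
  have int: "integrable (measure_pmf M) (indicator S :: 'a \<Rightarrow> real)" for S
    by (rule integrable_real_indicator) (auto simp: less_top[symmetric])
  have "2 * s * E1 - s\<^sup>2 * E2 = measure_pmf.expectation M (\<lambda>x. 2 * s * X x - s\<^sup>2 * (X x)\<^sup>2)"
    unfolding X2 unfolding X_def E1_def E2_def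
    by (simp add: measure_pmf.integrable_const_bound[where B = 1])
  also have "\<dots> \<le> measure_pmf.expectation M (indicator {x. \<exists>v\<in>V. P v x})"
  proof (intro integral_mono)
    show "integrable (measure_pmf M) (\<lambda>x. 2 * s * X x - s\<^sup>2 * (X x)\<^sup>2)"
      unfolding X2 unfolding X_def
      by (intro Bochner_Integration.integrable_diff integrable_mult_right
          Bochner_Integration.integrable_sum int)
    fix x
    show "2 * s * X x - s\<^sup>2 * (X x)\<^sup>2 \<le> indicator {x. \<exists>v\<in>V. P v x} x"
    proof (cases "\<exists>v\<in>V. P v x")
      case True
      have "0 \<le> (1 - s * X x)\<^sup>2" by simp
      with True show ?thesis
        by (simp add: power2_eq_square algebra_simps)
    next
      case False
      then show ?thesis by (simp add: X_def)
    qed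
  qed (rule int)
  also have "\<dots> = measure_pmf.prob M {x. \<exists>v\<in>V. P v x}" by simp
  finally have "2 * s * E1 - s\<^sup>2 * E2 \<le> measure_pmf.prob M {x. \<exists>v\<in>V. P v x}" .
  \<comment> \<open>This also covers \<open>E2 = 0\<close>: division by zero yields zero, so both
    sides vanish.\<close>
  moreover have "2 * s * E1 - s\<^sup>2 * E2 = E1\<^sup>2 / E2"
    by (simp add: s_def power2_eq_square)
  ultimately show ?thesis
    unfolding E1_def E2_def by simp
qed

subsection \<open>Vertex degrees and independent sets in random graphs\<close>

lemma card_star_minus_edge:
  assumes "finite V" "u \<in> V" "v \<in> V" "u \<noteq> v"
  shows "card ({e \<in> all_edges V. u \<in> e} - {{u, v}}) = card V - 2"
proof -
  have "{e \<in> all_edges V. u \<in> e} - {{u, v}} = (\<lambda>w. {u, w}) ` (V - {u, v})"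
  proof (intro equalityI subsetI)
    fix e assume e: "e \<in> {e \<in> all_edges V. u \<in> e} - {{u, v}}"
    then obtain x y where "e = {x, y}" "x \<noteq> y" by (auto simp: all_edges_def card_2_iff)
    with e show "e \<in> (\<lambda>w. {u, w}) ` (V - {u, v})"
      by (auto simp: all_edges_def insert_commute)
  qed (use assms in \<open>auto simp: all_edges_def doubleton_eq_iff\<close>)
  moreover have "inj_on (\<lambda>w. {u, w}) (V - {u, v})"
    by (auto simp: inj_on_def doubleton_eq_iff)
  ultimately show ?thesis
    using assms by (simp add: card_image card_Diff_subset)
qed

text \<open>The two degrees depend on each other only through the edge \<open>{u, v}\<close>. Given
  whether it is present, they come from disjoint stars of \<open>card V - 2\<close> edges each; the
  preimages under \<open>Suc\<close> account for the edge being counted at both ends.\<close>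

lemma prob_degrees_in:
  fixes D\<^sub>1 D\<^sub>2 :: "nat set"
  assumes V: "finite V" and uv: "u \<in> V" "v \<in> V" "u \<noteq> v" and q: "q \<in> {0..1}"
  shows "measure_pmf.prob (random_subset (all_edges V) q)
      {E. vertex_degree E u \<in> D\<^sub>1 \<and> vertex_degree E v \<in> D\<^sub>2} =
    (1 - q) * measure_pmf.prob (binomial_pmf (card V - 2) q) D\<^sub>1
      * measure_pmf.prob (binomial_pmf (card V - 2) q) D\<^sub>2 +
    q * measure_pmf.prob (binomial_pmf (card V - 2) q) (Suc -` D\<^sub>1)
      * measure_pmf.prob (binomial_pmf (card V - 2) q) (Suc -` D\<^sub>2)"
proof -
  let ?I = "all_edges V" and ?e = "{u, v}" and ?B = "binomial_pmf (card V - 2) q"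
  define star where "star w = {e \<in> ?I. w \<in> e} - {?e}" for w
  let ?f = "\<lambda>X. (card (X \<inter> star u), card (X \<inter> star v), card (X \<inter> {?e}))"
  let ?M = "pair_pmf ?B (pair_pmf ?B (binomial_pmf 1 q))"
  have fin: "finite ?I" using V by (rule finite_all_edges)
  have e: "?e \<in> ?I" using uv by (auto simp: all_edges_def)
  have disj: "star u \<inter> star v = {}"
  proof -
    have "e = ?e" if "e \<in> ?I" "u \<in> e" "v \<in> e" for e
      using that uv(3) card_subset_eq[of e ?e]
      by (auto simp: all_edges_def card_ge_0_finite)
    then show ?thesis by (auto simp: star_def)
  qed
  have card_star: "card (star u) = card V - 2" "card (star v) = card V - 2"
    using card_star_minus_edge[OF V uv] card_star_minus_edge[OF V uv(2,1) uv(3)[symmetric]]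
    by (simp_all only: star_def insert_commute[of v u])
  have M: "map_pmf ?f (random_subset ?I q) = ?M"
  proof -
    have "star u \<subseteq> ?I" "star v \<subseteq> ?I" "star u \<inter> {?e} = {}" "star v \<inter> {?e} = {}"
      by (auto simp: star_def)
    then show ?thesis
      using card_triple_random_subset[OF fin, of "star u" "star v" "{?e}" q] disj e q
      by (simp add: card_star)
  qed
  have deg: "vertex_degree X w = card (X \<inter> star w) + card (X \<inter> {?e})"
    if X: "X \<subseteq> ?I" and w: "w = u \<or> w = v" for X w
  proof -
    have finX: "finite X" using X fin by (rule finite_subset)
    have split: "{f \<in> X. w \<in> f} = (X \<inter> star w) \<union> (X \<inter> {?e})"
      using X w unfolding star_def by blast
    show ?thesis
      unfolding vertex_degree_def split
      by (rule card_Un_disjoint) (use finX in \<open>auto simp: star_def\<close>)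
  qed
  let ?T = "{(i, j, k). i + k \<in> D\<^sub>1 \<and> j + k \<in> D\<^sub>2}"
  let ?Z = "D\<^sub>1 \<times> D\<^sub>2 \<times> {0}" and ?W = "(Suc -` D\<^sub>1) \<times> (Suc -` D\<^sub>2) \<times> {1::nat}"
  have "measure_pmf.prob (random_subset ?I q)
      {E. vertex_degree E u \<in> D\<^sub>1 \<and> vertex_degree E v \<in> D\<^sub>2} =
      measure_pmf.prob (random_subset ?I q) (?f -` ?T)"
  proof (intro measure_pmf.finite_measure_eq_AE AE_pmfI)
    fix X assume "X \<in> set_pmf (random_subset ?I q)"
    then have "X \<subseteq> ?I" using set_pmf_random_subset by blast
    then show "X \<in> {E. vertex_degree E u \<in> D\<^sub>1 \<and> vertex_degree E v \<in> D\<^sub>2} \<longleftrightarrow> X \<in> ?f -` ?T"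
      by (simp only: deg vimage_eq mem_Collect_eq prod.case simp_thms)
  qed auto
  also have "\<dots> = measure_pmf.prob ?M ?T"
    unfolding M[symmetric] by simp
  \<comment> \<open>The last coordinate is almost surely 0 or 1, and \<open>?Z\<close> and
    \<open>?W\<close> are the parts of \<open>?T\<close> with these values.\<close>
  also have "\<dots> = measure_pmf.prob ?M (?Z \<union> ?W)"
  proof (intro measure_pmf.finite_measure_eq_AE AE_pmfI)
    fix x assume x: "x \<in> set_pmf ?M"
    obtain i j k where ijk: "x = (i, j, k)" by (cases x)
    with x have "k \<in> set_pmf (binomial_pmf 1 q)" by simp
    then have "k = 0 \<or> k = 1"
      using q set_pmf_binomial_eq[of q 1] by (auto split: if_splits)
    then show "x \<in> ?T \<longleftrightarrow> x \<in> ?Z \<union> ?W"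
      unfolding ijk by (elim disjE) simp_all
  qed auto
  also have "\<dots> = measure_pmf.prob ?M ?Z + measure_pmf.prob ?M ?W"
    by (intro measure_pmf.finite_measure_Union) auto
  finally show ?thesis
    using q by (simp add: measure_pmf_prob_product measure_pmf_single)
qed

text \<open>The second moment bound for the number of vertices with degree in \<open>D\<close>. In
  the denominator the diagonal pairs contribute the mean, and the \<open>n * (n - 1)\<close> ordered
  pairs of distinct vertices share one joint probability.\<close>

lemma prob_exists_degree_in:
  fixes D :: "nat set"
  assumes V: "finite V" "card V \<ge> 2" and q: "q \<in> {0..1}"
  defines "n \<equiv> real (card V)"
  defines "a \<equiv> measure_pmf.prob (binomial_pmf (card V - 2) q) D"
  defines "b \<equiv> measure_pmf.prob (binomial_pmf (card V - 2) q) (Suc -` D)"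
  shows "(n * ((1 - q) * a + q * b))\<^sup>2 /
      (n * ((1 - q) * a + q * b) + n * (n - 1) * ((1 - q) * a\<^sup>2 + q * b\<^sup>2)) \<le>
    measure_pmf.prob (random_subset (all_edges V) q) {E. \<exists>v\<in>V. vertex_degree E v \<in> D}"
proof -
  let ?M = "random_subset (all_edges V) q"
  have one: "measure_pmf.prob ?M {E. vertex_degree E u \<in> D} = (1 - q) * a + q * b" if u: "u \<in> V" for u
  proof -
    have "card (V - {u}) \<noteq> 0" using V u by simp
    then obtain v where "v \<in> V" "v \<noteq> u"
      by (metis Diff_iff card.empty ex_in_conv singletonI)
    then show ?thesis
      \<comment> \<open>The one-vertex probability is the pair formula with no condition on an
        auxiliary second vertex \<open>v\<close>.\<close>
      using prob_degrees_in[OF V(1) u _ _ q, of v D UNIV] by (simp add: a_def b_def)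
  qed
  have two: "measure_pmf.prob ?M {E. vertex_degree E u \<in> D \<and> vertex_degree E v \<in> D} =
      (1 - q) * a\<^sup>2 + q * b\<^sup>2" if "u \<in> V" "v \<in> V" "u \<noteq> v" for u v
    using prob_degrees_in[OF V(1) that q, of D D]
    by (simp add: a_def b_def power2_eq_square algebra_simps)
  have "(\<Sum>v\<in>V. measure_pmf.prob ?M {E. vertex_degree E u \<in> D \<and> vertex_degree E v \<in> D}) =
      ((1 - q) * a + q * b) + (n - 1) * ((1 - q) * a\<^sup>2 + q * b\<^sup>2)" if u: "u \<in> V" for u
  proof -
    have "real (card (V - {u})) = n - 1"
      using V u by (simp add: n_def)
    moreover have "(\<Sum>v\<in>V - {u}. measure_pmf.prob ?M
        {E. vertex_degree E u \<in> D \<and> vertex_degree E v \<in> D}) =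
        (\<Sum>v\<in>V - {u}. (1 - q) * a\<^sup>2 + q * b\<^sup>2)"
      using u by (intro sum.cong refl two) auto
    ultimately show ?thesis
      by (subst sum.remove[OF V(1) u]) (simp only: conj_absorb one[OF u] sum_constant)
  qed
  then have "(\<Sum>u\<in>V. \<Sum>v\<in>V. measure_pmf.prob ?M
        {E. vertex_degree E u \<in> D \<and> vertex_degree E v \<in> D}) =
      n * ((1 - q) * a + q * b) + n * (n - 1) * ((1 - q) * a\<^sup>2 + q * b\<^sup>2)"
    by (simp add: n_def distrib_left mult.assoc)
  moreover have "(\<Sum>v\<in>V. measure_pmf.prob ?M {E. vertex_degree E v \<in> D}) =
      n * ((1 - q) * a + q * b)"
    by (simp add: one n_def)
  ultimately show ?thesis
    using second_moment[OF V(1), of ?M "\<lambda>v E. vertex_degree E v \<in> D"] by simp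
qed

section \<open>Independent sets and limits at particular edge probabilities\<close>

lemma choose_two_real: "real (n choose 2) = real n * (real n - 1) / 2"
  by (cases n) (simp_all add: choose_two real_of_nat_div algebra_simps)

text \<open>Union bound over the sets of size \<open>m\<close>, of which there are at most
  \<open>2 ^ card V\<close>.\<close>

lemma prob_independent_set_le:
  assumes V: "finite V" and q: "q \<in> {0..1}"
  shows "measure_pmf.prob (random_subset (all_edges V) q)
      {E. \<exists>S\<subseteq>V. card S = m \<and> E \<inter> all_edges S = {}} \<le>
    2 ^ card V * (1 - q) ^ (m choose 2)"
proof -
  let ?M = "random_subset (all_edges V) q" and ?F = "{S. S \<subseteq> V \<and> card S = m}"
  have finF: "finite ?F" using V by (auto intro: finite_subset[of _ "Pow V"])
  have "measure_pmf.prob ?M {E. \<exists>S\<subseteq>V. card S = m \<and> E \<inter> all_edges S = {}} =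
      measure_pmf.prob ?M (\<Union>S\<in>?F. {E. E \<inter> all_edges S = {}})"
    by (auto intro!: arg_cong2[where f = measure])
  also have "\<dots> \<le> (\<Sum>S\<in>?F. measure_pmf.prob ?M {E. E \<inter> all_edges S = {}})"
    using finF by (intro measure_pmf.finite_measure_subadditive_finite) auto
  also have "\<dots> = (\<Sum>S\<in>?F. (1 - q) ^ (m choose 2))"
  proof (intro sum.cong refl)
    fix S assume S: "S \<in> ?F"
    then have "card (all_edges S) = m choose 2"
      using V unfolding all_edges_def by (auto simp: n_subsets dest: finite_subset)
    moreover have "all_edges S \<subseteq> all_edges V" using S by (auto simp: all_edges_def)
    ultimately show "measure_pmf.prob ?M {E. E \<inter> all_edges S = {}} = (1 - q) ^ (m choose 2)"
      using prob_Int_empty_random_subset[OF finite_all_edges[OF V] _ q] by simp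
  qed
  also have "\<dots> \<le> 2 ^ card V * (1 - q) ^ (m choose 2)"
  proof -
    have "card ?F \<le> 2 ^ card V"
      using card_mono[of "Pow V" ?F] V by (auto simp: card_Pow)
    then have "real (card ?F) \<le> 2 ^ card V"
      by (metis of_nat_le_iff of_nat_numeral of_nat_power)
    then show ?thesis using q by (auto intro!: mult_right_mono)
  qed
  finally show ?thesis .
qed

text \<open>The mean number of isolated vertices grows linearly, and distinct vertices are
  asymptotically uncorrelated, so the second moment bound tends to 1.\<close>

lemma tendsto_exists_isolated_vertex:
  "((\<lambda>n. measure_pmf.prob (gnp n (16 / n)) {E. \<exists>v\<in>{1..n}. vertex_degree E v = 0}) \<longlongrightarrow> 1) at_top"
proof -
  define a where "a n = (1 - 16 / real n) powr (real n - 2)" for n :: nat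
  define f where "f n = (real n * ((1 - 16 / n) * a n))\<^sup>2 /
    (real n * ((1 - 16 / n) * a n) + n * (real n - 1) * ((1 - 16 / n) * (a n)\<^sup>2))" for n :: nat
  have "f \<longlonglongrightarrow> 1"
    unfolding f_def a_def by real_asymp
  note lim = this
  have bound: "\<forall>\<^sub>F n in at_top. f n \<le>
      measure_pmf.prob (gnp n (16 / n)) {E. \<exists>v\<in>{1..n}. vertex_degree E v = 0}"
    using eventually_gt_at_top[of 16]
  proof eventually_elim
    case (elim n)
    have "pmf (binomial_pmf (n - 2) (16 / n)) 0 = a n"
      using elim by (simp add: a_def powr_realpow[symmetric] of_nat_diff)
    \<comment> \<open>A present edge excludes degree zero, so the term for the edge joining the two
      vertices drops out.\<close>
    moreover have "Suc -` {0} = {}" by auto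
    ultimately show ?case
      using prob_exists_degree_in[of "{1..n}" "16 / n" "{0}"] elim
      by (simp add: f_def gnp_eq_random_subset measure_pmf_single)
  qed
  show ?thesis
    by (rule tendsto_sandwich[OF bound _ lim tendsto_const]) simp
qed

lemma tendsto_independent_set:
  "((\<lambda>n. measure_pmf.prob (gnp n (16 / n))
      {E. \<exists>S\<subseteq>{1..n}. card S = n div 2 \<and> E \<inter> all_edges S = {}}) \<longlongrightarrow> 0) at_top"
proof -
  \<comment> \<open>The second exponent is asymptotic to \<open>- 2 * n\<close>; the constant 16 is
    large enough to beat the factor \<open>exp n\<close>, which bounds the number
    \<open>2 ^ n\<close> of vertex sets.\<close>
  have "(\<lambda>n::nat. exp (real n) * exp (- 16 / real n * (((real n - 1) / 2) * ((real n - 1) / 2 - 1) / 2))) \<longlonglongrightarrow> 0"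
    by real_asymp
  note lim = this
  have bound: "\<forall>\<^sub>F n in at_top. measure_pmf.prob (gnp n (16 / n))
      {E. \<exists>S\<subseteq>{1..n}. card S = n div 2 \<and> E \<inter> all_edges S = {}} \<le>
      exp (real n) * exp (- 16 / real n * (((real n - 1) / 2) * ((real n - 1) / 2 - 1) / 2))"
    using eventually_gt_at_top[of 16]
  proof eventually_elim
    case (elim n)
    define m where "m = n div 2"
    \<comment> \<open>A lower bound on \<open>n div 2\<close> that is valid for both parities of
      \<open>n\<close>.\<close>
    have m: "(real n - 1) / 2 \<le> real m"
    proof -
      have "n \<le> 2 * m + 1" unfolding m_def by presburger
      then have "real n \<le> real (2 * m + 1)" by (simp only: of_nat_le_iff)
      then show ?thesis by simp
    qed
    have "((real n - 1) / 2) * ((real n - 1) / 2 - 1) / 2 \<le> real m * (real m - 1) / 2"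
      using m elim by (intro divide_right_mono mult_mono) auto
    also have "\<dots> = real (m choose 2)"
      by (simp add: choose_two_real)
    finally have choose: "((real n - 1) / 2) * ((real n - 1) / 2 - 1) / 2 \<le> real (m choose 2)" .
    have "(1 - 16 / real n) ^ (m choose 2) \<le> exp (- 16 / real n) ^ (m choose 2)"
      using elim exp_ge_add_one_self[of "- 16 / real n"] by (intro power_mono) auto
    also have "\<dots> = exp (- 16 / real n * real (m choose 2))"
      by (simp add: exp_of_nat_mult[symmetric] mult.commute)
    also have "\<dots> \<le> exp (- 16 / real n * (((real n - 1) / 2) * ((real n - 1) / 2 - 1) / 2))"
      using elim choose by (simp add: divide_right_mono)
    finally have "(1 - 16 / real n) ^ (m choose 2) \<le>
      exp (- 16 / real n * (((real n - 1) / 2) * ((real n - 1) / 2 - 1) / 2))" .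
    moreover have "(2::real) ^ n \<le> exp (real n)"
      using power_mono[of 2 "exp 1 :: real" n] exp_ge_add_one_self[of "1 :: real"]
      by (simp add: exp_of_nat_mult[symmetric])
    ultimately have "2 ^ n * (1 - 16 / real n) ^ (m choose 2) \<le> exp (real n) *
        exp (- 16 / real n * (((real n - 1) / 2) * ((real n - 1) / 2 - 1) / 2))"
      using elim by (intro mult_mono) auto
    then show ?case
      using prob_independent_set_le[of "{1..n}" "16 / n" m] elim
      by (simp add: gnp_eq_random_subset m_def[symmetric])
  qed
  show ?thesis
    by (rule tendsto_sandwich[OF _ bound tendsto_const lim]) simp
qed

text \<open>The second moment bound tends to \<open>\<mu>\<^sup>2 / (\<mu> + \<mu>\<^sup>2)\<close>,
  which is positive; half of it serves as \<epsilon>. A constant bound suffices, since it keeps the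
  complementary event from having probability tending to 1.\<close>

lemma eventually_exists_degree_2:
  fixes c :: real
  shows "\<exists>\<epsilon>>0. \<forall>\<^sub>F n in at_top. \<epsilon> \<le> measure_pmf.prob
    (gnp n ((ln n + 2 * ln (ln n) + c) / n)) {E. \<exists>v\<in>{1..n}. vertex_degree E v = 2}"
proof -
  define \<mu> where "\<mu> = exp (- c) / 2"
  define q where "q n = (ln (real n) + 2 * ln (ln (real n)) + c) / real n" for n :: nat
  \<comment> \<open>\<open>a n\<close> and \<open>b n\<close> are the binomial probabilities of the
    values 2 and 1 among \<open>n - 2\<close> trials; real powers make the limits accessible to
    analysis.\<close>
  define a where "a n = (real n - 2) * (real n - 3) / 2 * (q n)\<^sup>2 * (1 - q n) powr (real n - 4)" for n :: nat
  define b where "b n = (real n - 2) * q n * (1 - q n) powr (real n - 3)" for n :: nat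
  define E1 where "E1 n = (1 - q n) * (n * a n) + q n * (n * b n)" for n :: nat
  \<comment> \<open>The second moment, with \<open>n * (n - 1)\<close> written as
    \<open>(1 - 1 / n) * n\<^sup>2\<close> so that only the convergent quantities
    \<open>n * a n\<close> and \<open>n * b n\<close> occur.\<close>
  define E2 where "E2 n = E1 n + (1 - 1 / n) * ((1 - q n) * (n * a n)\<^sup>2 + q n * (n * b n)\<^sup>2)" for n :: nat
  have q: "q \<longlonglongrightarrow> 0" unfolding q_def by real_asymp
  define L where "L n = ln (real n) + 2 * ln (ln (real n)) + c" for n :: nat
  have q_L: "q n = L n / n" for n by (simp add: q_def L_def)
  have L: "(\<lambda>n. L n / ln n) \<longlonglongrightarrow> 1" unfolding L_def by real_asymp
  \<comment> \<open>The main term is \<open>exp (- L n)\<close>; the remaining exponential is a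
    correction. For exponents \<open>n - k\<close> with fixed \<open>k\<close> it tends to 1,
    because \<open>n * (q n)\<^sup>2\<close> tends to 0.\<close>
  have pow_eq: "(1 - q n) powr k = exp (- c) / (n * (ln n)\<^sup>2) * exp (k * ln (1 - q n) + L n)"
    if "n > 16" "q n < 1" for n :: nat and k
  proof -
    have "exp (L n) = n * (ln n)\<^sup>2 * exp c"
      using that(1) by (simp add: L_def exp_add exp_double)
    then show ?thesis
      using that by (simp add: powr_def exp_add exp_minus)
  qed
  have pow_lim: "(\<lambda>n. exp ((real n - k) * ln (1 - q n) + L n)) \<longlonglongrightarrow> exp 0" for k :: real
    unfolding q_def L_def by (intro tendsto_exp) real_asymp
  have ev: "\<forall>\<^sub>F n in at_top. n > 16 \<and> q n < 1"
    using order_tendstoD(2)[OF q, of 1] eventually_gt_at_top[of 16] by (simp add: eventually_conj)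
  \<comment> \<open>Rearrangements with \<open>x\<close> for \<open>n\<close>, \<open>l\<close> for
    \<open>ln n\<close>, \<open>r\<close> for \<open>L n\<close>, \<open>e\<close> for
    \<open>exp (- c)\<close> and \<open>y\<close> for the correction factor.\<close>
  have alg_a: "k / x\<^sup>2 * (r / l)\<^sup>2 * (e / 2) * y = x * (k / 2 * (r / x)\<^sup>2 * (e / (x * l\<^sup>2) * y))"
    and alg_b: "k / x * (r / l) * (1 / l) * e * y = x * (k * (r / x) * (e / (x * l\<^sup>2) * y))"
    if "x \<noteq> 0" "l \<noteq> 0" for x l k r e y :: real
    using that by (simp_all add: field_simps power2_eq_square)
  have na: "(\<lambda>n. n * a n) \<longlonglongrightarrow> \<mu>"
  proof -
    have "(\<lambda>n. (real n - 2) * (real n - 3) / (real n)\<^sup>2) \<longlonglongrightarrow> 1" by real_asymp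
    note lims = this L pow_lim[of 4]
    have "(\<lambda>n. (real n - 2) * (real n - 3) / (real n)\<^sup>2 * (L n / ln n)\<^sup>2 * \<mu> *
        exp ((real n - 4) * ln (1 - q n) + L n)) \<longlonglongrightarrow> 1 * 1\<^sup>2 * \<mu> * exp 0"
      by (intro tendsto_intros lims)
    moreover have "\<forall>\<^sub>F n in at_top. (real n - 2) * (real n - 3) / (real n)\<^sup>2 * (L n / ln n)\<^sup>2 * \<mu> *
        exp ((real n - 4) * ln (1 - q n) + L n) = n * a n"
      using ev
    proof eventually_elim
      case (elim n)
      define X where "X = exp ((real n - 4) * ln (1 - q n) + L n)"
      have eq: "a n = (real n - 2) * (real n - 3) / 2 * (q n)\<^sup>2 * (exp (- c) / (n * (ln n)\<^sup>2) * X)"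
        using elim by (simp add: a_def X_def pow_eq)
      show ?case
        using conjunct1[OF elim] unfolding X_def[symmetric] eq unfolding \<mu>_def q_L
        by (intro alg_a) auto
    qed
    ultimately show ?thesis by (simp add: tendsto_cong)
  qed
  \<comment> \<open>One factor \<open>L n\<close> against two factors \<open>ln n\<close> leaves
    order \<open>1 / ln n\<close>; in \<open>n * a n\<close> they balance.\<close>
  have nb: "(\<lambda>n. n * b n) \<longlonglongrightarrow> 0"
  proof -
    have "(\<lambda>n. (real n - 2) / real n) \<longlonglongrightarrow> 1" "(\<lambda>n::nat. 1 / ln n) \<longlonglongrightarrow> 0" by real_asymp+
    note lims = this L pow_lim[of 3]
    have "(\<lambda>n. (real n - 2) / real n * (L n / ln n) * (1 / ln n) * exp (- c) *
        exp ((real n - 3) * ln (1 - q n) + L n)) \<longlonglongrightarrow> 1 * 1 * 0 * exp (- c) * exp 0"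
      by (intro tendsto_intros lims)
    moreover have "\<forall>\<^sub>F n in at_top. (real n - 2) / real n * (L n / ln n) * (1 / ln n) * exp (- c) *
        exp ((real n - 3) * ln (1 - q n) + L n) = n * b n"
      using ev
    proof eventually_elim
      case (elim n)
      define X where "X = exp ((real n - 3) * ln (1 - q n) + L n)"
      have eq: "b n = (real n - 2) * q n * (exp (- c) / (n * (ln n)\<^sup>2) * X)"
        using elim by (simp add: b_def X_def pow_eq)
      show ?case
        using conjunct1[OF elim] unfolding X_def[symmetric] eq unfolding q_L
        by (intro alg_b) auto
    qed
    ultimately show ?thesis by (simp add: tendsto_cong)
  qed
  have "(\<lambda>n::nat. 1 / real n) \<longlonglongrightarrow> 0" by real_asymp
  note lims = q na nb this
  have "E1 \<longlonglongrightarrow> (1 - 0) * \<mu> + 0 * 0"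
    unfolding E1_def by (intro tendsto_intros lims)
  then have E1: "E1 \<longlonglongrightarrow> \<mu>" by simp
  have "E2 \<longlonglongrightarrow> \<mu> + (1 - 0) * ((1 - 0) * \<mu>\<^sup>2 + 0 * 0\<^sup>2)"
    unfolding E2_def by (intro tendsto_intros lims E1)
  then have E2: "E2 \<longlonglongrightarrow> \<mu> + \<mu>\<^sup>2" by simp
  have \<mu>: "\<mu> > 0" by (simp add: \<mu>_def)
  have lim: "(\<lambda>n. (E1 n)\<^sup>2 / E2 n) \<longlonglongrightarrow> \<mu>\<^sup>2 / (\<mu> + \<mu>\<^sup>2)"
    using \<mu> by (intro tendsto_intros E1 E2) (auto simp: add_pos_pos less_imp_neq[symmetric])
  define M where "M = \<mu>\<^sup>2 / (\<mu> + \<mu>\<^sup>2)"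
  have "M > 0" using \<mu> by (simp add: M_def add_pos_pos)
  define \<epsilon> where "\<epsilon> = M / 2"
  have \<epsilon>: "\<epsilon> > 0" "\<epsilon> < M" using \<open>M > 0\<close> by (auto simp: \<epsilon>_def)
  have "\<forall>\<^sub>F n in at_top. q n > 0"
    using order_tendstoD(1)[OF L zero_less_one] eventually_gt_at_top[of 16]
    by eventually_elim (simp add: q_L zero_less_divide_iff)
  moreover have "\<forall>\<^sub>F n in at_top. q n < 1" using q by (rule order_tendstoD) simp
  moreover have "\<forall>\<^sub>F n in at_top. \<epsilon> < (E1 n)\<^sup>2 / E2 n" using lim[folded M_def] \<epsilon>(2) by (rule order_tendstoD)
  ultimately have "\<forall>\<^sub>F n in at_top. \<epsilon> \<le> measure_pmf.prob (gnp n (q n)) {E. \<exists>v\<in>{1..n}. vertex_degree E v = 2}"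
    using eventually_gt_at_top[of 16]
  proof eventually_elim
    case (elim n)
    have pow: "(1 - q n) powr (real n - real k) = (1 - q n) ^ (n - k)" if "k \<le> n" for k
      using powr_realpow[of "1 - q n" "n - k"] elim that by (simp add: of_nat_diff)
    have "pmf (binomial_pmf (n - 2) (q n)) 2 = a n"
      using elim pow[of 4] by (simp add: a_def choose_two_real of_nat_diff)
    moreover have "pmf (binomial_pmf (n - 2) (q n)) 1 = b n"
      using elim pow[of 3] by (simp add: b_def of_nat_diff)
    moreover have "Suc -` {2} = {1}" by auto
    moreover have "E1 n = n * ((1 - q n) * a n + q n * b n)"
      by (simp add: E1_def algebra_simps)
    moreover have "E2 n = E1 n + n * (real n - 1) * ((1 - q n) * (a n)\<^sup>2 + q n * (b n)\<^sup>2)"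
    proof -
      have "(1 - 1 / x) * ((1 - r) * (x * y)\<^sup>2 + r * (x * z)\<^sup>2) =
          x * (x - 1) * ((1 - r) * y\<^sup>2 + r * z\<^sup>2)" if "x \<noteq> 0" for x y z r :: real
        using that by (simp add: field_simps power2_eq_square)
      from this[of "real n"] show ?thesis
        using elim by (simp add: E2_def)
    qed
    ultimately show ?case
      using prob_exists_degree_in[of "{1..n}" "q n" "{2}"] elim
      by (simp add: gnp_eq_random_subset measure_pmf_single)
  qed
  then show ?thesis
    using \<epsilon>(1) unfolding q_def by blast
qed

subsection \<open>The lower bound on the edge probability\<close>

lemma random_subset_antimono:
  assumes "finite I" "0 \<le> p" "p \<le> q" "q \<le> 1"
    and antimono: "\<And>X Y. X \<subseteq> Y \<Longrightarrow> Y \<subseteq> I \<Longrightarrow> P Y \<Longrightarrow> P X"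
  shows "measure_pmf.prob (random_subset I q) {X. P X} \<le>
    measure_pmf.prob (random_subset I p) {X. P X}"
proof -
  have compl: "measure_pmf.prob (random_subset I r) {X. \<not> P X} =
      1 - measure_pmf.prob (random_subset I r) {X. P X}" for r
    using measure_pmf.prob_compl[of "{X. P X}" "random_subset I r"] by (simp add: Compl_eq_Diff_UNIV[symmetric] Collect_neg_eq)
  show ?thesis
    using random_subset_mono[OF assms(1-4), of "\<lambda>X. \<not> P X"] antimono
    by (auto simp: compl)
qed

text \<open>A Hamilton circuit forces all degrees to be at least two, and a vertex of degree exactly
  two yields the independent set. The first alternative is monotone in \<open>E\<close> and the
  second antitone, so each can be transported by coupling.\<close>

lemma spanned_by_hamilton_circuits_dichotomy:
  assumes V: "finite V" "odd (card V)" and E: "E \<subseteq> all_edges V"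
    and "\<not> is_forest V E" and span: "cycle_space V E = F2_span (hamilton_circuits V E)"
  shows "(\<forall>v\<in>V. 3 \<le> vertex_degree E v) \<or> (\<exists>S\<subseteq>V. card S = card V div 2 \<and> E \<inter> all_edges S = {})"
proof (cases "\<exists>v\<in>V. vertex_degree E v = 2")
  case True
  then show ?thesis
    using independent_set_if_degree_2[OF V E span] by blast
next
  case False
  have "2 \<le> vertex_degree E v" if "v \<in> V" for v
    using degree_ge_2_if_hamiltonian[OF V(1) E _ that] hamiltonian_if_spanned[OF V(1) E] assms
    by blast
  with False have "3 \<le> vertex_degree E v" if "v \<in> V" for v
    using that by (metis Suc_leI le_neq_implies_less numeral_2_eq_2 numeral_3_eq_3)
  then show ?thesis by blast
qed

text \<open>Having a vertex of degree exactly \<open>k\<close> is not monotone in general. The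
  coupling is therefore applied to minimum degree above \<open>k\<close>, and the complement is
  taken only at \<open>q\<close>.\<close>

lemma prob_all_degrees_gt_le:
  assumes "0 \<le> p" "p \<le> q" "q \<le> 1"
  shows "measure_pmf.prob (gnp n p) {E. \<forall>v\<in>{1..n}. k < vertex_degree E v} \<le>
    1 - measure_pmf.prob (gnp n q) {E. \<exists>v\<in>{1..n}. vertex_degree E v = k}"
proof -
  let ?I = "all_edges {1..n}"
  have fin: "finite ?I" by (simp add: finite_all_edges)
  have "measure_pmf.prob (gnp n p) {E. \<forall>v\<in>{1..n}. k < vertex_degree E v} \<le>
      measure_pmf.prob (gnp n q) {E. \<forall>v\<in>{1..n}. k < vertex_degree E v}"
    unfolding gnp_eq_random_subset
  proof (rule random_subset_mono[OF fin assms])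
    fix X Y assume "X \<subseteq> Y" "Y \<subseteq> ?I" "\<forall>v\<in>{1..n}. k < vertex_degree X v"
    then show "\<forall>v\<in>{1..n}. k < vertex_degree Y v"
      using vertex_degree_mono[OF finite_subset[OF _ fin], of Y X] by (meson less_le_trans)
  qed
  also have "\<dots> \<le> measure_pmf.prob (gnp n q) (- {E. \<exists>v\<in>{1..n}. vertex_degree E v = k})"
    by (intro measure_pmf.finite_measure_mono) auto
  also have "\<dots> = 1 - measure_pmf.prob (gnp n q) {E. \<exists>v\<in>{1..n}. vertex_degree E v = k}"
    using measure_pmf.prob_compl[of "{E. \<exists>v\<in>{1..n}. vertex_degree E v = k}" "gnp n q"]
    by (simp add: Compl_eq_Diff_UNIV)
  finally show ?thesis .
qed

theorem theorem8:
  fixes p :: "nat \<Rightarrow> real"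
  assumes "\<And>n. p n \<in> {0..1}"
    and "aas_odd p (\<lambda>V E. \<not> is_forest V E \<and> \<not> is_circuit V E \<and>
           cycle_space V E = F2_span (hamilton_circuits V E))"
  shows "\<forall>c>0. \<forall>\<^sub>F n in odd_at_top. p n > (ln (real n) + 2 * ln (ln (real n)) + c) / real n"
proof (intro allI impI)
  fix c :: real assume "c > 0"
  define q where "q n = (ln (real n) + 2 * ln (ln (real n)) + c) / real n" for n :: nat
  define good where "good n = {E. \<not> is_forest {1..n} E \<and> \<not> is_circuit {1..n} E \<and>
    cycle_space {1..n} E = F2_span (hamilton_circuits {1..n} E)}" for n :: nat
  define isolated where "isolated n = {E. \<exists>v\<in>{1..n}. vertex_degree E v = 0}" for n :: nat
  define indep where "indep n = {E. \<exists>S\<subseteq>{1..n}. card S = n div 2 \<and> E \<inter> all_edges S = {}}" for n :: nat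
  define deg2 where "deg2 n = {E. \<exists>v\<in>{1..n}. vertex_degree E v = 2}" for n :: nat
  obtain \<epsilon> where \<epsilon>: "\<epsilon> > 0" "\<forall>\<^sub>F n in at_top. \<epsilon> \<le> measure_pmf.prob (gnp n (q n)) (deg2 n)"
    using eventually_exists_degree_2[of c] by (auto simp: q_def deg2_def)
  \<comment> \<open>For \<open>p n \<le> 16 / n\<close> the failure probability exceeds
    \<open>1 / 2\<close>; otherwise it is at least \<epsilon> minus the loss of
    \<open>\<epsilon> / 2\<close> from independent sets.\<close>
  define \<delta> where "\<delta> = min (1 / 2) (\<epsilon> / 2)"
  have \<delta>: "\<delta> > 0" using \<epsilon>(1) by (simp add: \<delta>_def)
  have isolated: "\<forall>\<^sub>F n in at_top. 1 / 2 < measure_pmf.prob (gnp n (16 / n)) (isolated n)"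
    using tendsto_exists_isolated_vertex unfolding isolated_def by (rule order_tendstoD) simp
  have indep: "\<forall>\<^sub>F n in at_top. measure_pmf.prob (gnp n (16 / n)) (indep n) < \<epsilon> / 2"
    using tendsto_independent_set unfolding indep_def by (rule order_tendstoD) (use \<epsilon> in simp)
  have "q \<longlonglongrightarrow> 0" unfolding q_def by real_asymp
  then have "\<forall>\<^sub>F n in at_top. q n < 1" by (rule order_tendstoD) simp
  then have "\<forall>\<^sub>F n in at_top. odd n \<longrightarrow> p n \<le> q n \<longrightarrow>
      measure_pmf.prob (gnp n (p n)) (good n) \<le> 1 - \<delta>"
    using eventually_gt_at_top[of 16] isolated indep \<epsilon>(2)
  proof eventually_elim
    case (elim n)
    show ?case
    proof (intro impI)
      assume n: "odd n" and pq: "p n \<le> q n"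
      let ?I = "all_edges {1..n}"
      have fin: "finite ?I" by (simp add: finite_all_edges)
      \<comment> \<open>\<open>good n\<close> also contains edge sets that leave the vertex set, so
        the structural lemmas are applied only on the support.\<close>
      have supp: "E \<subseteq> ?I" if "E \<in> set_pmf (gnp n (p n))" for E
        using that set_pmf_random_subset unfolding gnp_eq_random_subset by blast
      have p: "0 \<le> p n" "p n \<le> 1" using assms(1)[of n] by auto
      have dichotomy: "(\<forall>v\<in>{1..n}. 2 < vertex_degree E v) \<or> E \<in> indep n"
        if "E \<in> set_pmf (gnp n (p n))" "E \<in> good n" for E
        using spanned_by_hamilton_circuits_dichotomy[of "{1..n}" E] that supp n
        by (auto simp: good_def indep_def eval_nat_numeral Suc_le_eq)
      have no_isolated: "\<forall>v\<in>{1..n}. 0 < vertex_degree E v"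
        if "E \<in> set_pmf (gnp n (p n))" "E \<in> good n" for E
        using degree_ge_2_if_hamiltonian[of "{1..n}" E] hamiltonian_if_spanned[of "{1..n}" E]
          that supp by (fastforce simp: good_def)
      show "measure_pmf.prob (gnp n (p n)) (good n) \<le> 1 - \<delta>"
      proof (cases "p n \<le> 16 / n")
        case True
        have "measure_pmf.prob (gnp n (p n)) (good n) \<le>
            measure_pmf.prob (gnp n (p n)) {E. \<forall>v\<in>{1..n}. 0 < vertex_degree E v}"
          using no_isolated by (intro measure_pmf.finite_measure_mono_AE AE_pmfI) auto
        also have "\<dots> \<le> 1 - measure_pmf.prob (gnp n (16 / n)) (isolated n)"
          unfolding isolated_def using True p elim(2) by (intro prob_all_degrees_gt_le) auto
        finally show ?thesis using elim(3) by (simp add: \<delta>_def)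
      next
        case False
        have "measure_pmf.prob (gnp n (p n)) (good n) \<le>
            measure_pmf.prob (gnp n (p n)) ({E. \<forall>v\<in>{1..n}. 2 < vertex_degree E v} \<union> indep n)"
          using dichotomy by (intro measure_pmf.finite_measure_mono_AE AE_pmfI) auto
        also have "\<dots> \<le> measure_pmf.prob (gnp n (p n)) {E. \<forall>v\<in>{1..n}. 2 < vertex_degree E v} +
            measure_pmf.prob (gnp n (p n)) (indep n)"
          by (intro measure_Un_le) auto
        finally have "measure_pmf.prob (gnp n (p n)) (good n) \<le>
            measure_pmf.prob (gnp n (p n)) {E. \<forall>v\<in>{1..n}. 2 < vertex_degree E v} +
            measure_pmf.prob (gnp n (p n)) (indep n)" .
        moreover have "measure_pmf.prob (gnp n (p n)) {E. \<forall>v\<in>{1..n}. 2 < vertex_degree E v} \<le>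
            1 - measure_pmf.prob (gnp n (q n)) (deg2 n)"
          unfolding deg2_def using p pq elim(1) by (intro prob_all_degrees_gt_le) auto
        \<comment> \<open>Independent sets survive deletion of edges, so above \<open>16 / n\<close>
          they are no likelier than at \<open>16 / n\<close>.\<close>
        moreover have "measure_pmf.prob (gnp n (p n)) (indep n) \<le>
            measure_pmf.prob (gnp n (16 / n)) (indep n)"
          unfolding gnp_eq_random_subset indep_def using False p
          by (intro random_subset_antimono[OF fin]) (auto, blast)
        ultimately show ?thesis using elim by (simp add: \<delta>_def)
      qed
    qed
  qed
  then have "\<forall>\<^sub>F n in odd_at_top. p n \<le> q n \<longrightarrow>
      measure_pmf.prob (gnp n (p n)) (good n) \<le> 1 - \<delta>"
    by (simp add: odd_at_top_def eventually_inf_principal)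
  moreover have "\<forall>\<^sub>F n in odd_at_top. 1 - \<delta> < measure_pmf.prob (gnp n (p n)) (good n)"
    using assms(2) unfolding aas_odd_def good_def by (rule order_tendstoD) (use \<delta> in simp)
  \<comment> \<open>If \<open>p n \<le> q n\<close>, the upper bound on the probability of
    \<open>good n\<close> contradicts its convergence to 1.\<close>
  ultimately have "\<forall>\<^sub>F n in odd_at_top. q n < p n"
    by eventually_elim auto
  then show "\<forall>\<^sub>F n in odd_at_top. p n > (ln (real n) + 2 * ln (ln (real n)) + c) / real n"
    by (simp add: q_def)
qed

end
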